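(* Let $n$ be a positive integer, let $\mathrm{Perm}_n\subset\mathbb{R}^n$ be the permutohedron of order $n$, and let $\mathrm{Asso}_n\subset\mathbb{R}^n$ be Loday's polytopal realisation of the associahedron. Identify a permutation $u$ of $[n]=\{1,\dots,n\}$ both with the vector $(u(1),\dots,u(n))\in\mathbb{R}^n$ and with the linear order on $[n]$ written as the sequence $u(1)u(2)\cdots u(n)$. Then $$\mathrm{Perm}_n\cap\mathrm{Asso}_n=(\cdots((1\star 2)\star 3)\star\cdots)\star n$$ is the maximal never-middle Condorcet domain of size $2^{n-1}$.
   Context: **Permutohedron.** $\mathrm{Perm}_n$ is the $(n-1)$-dimensional polytope in $\mathbb{R}^n$ whose vertices are the $n!$ points $(u(1),\dots,u(n))$, where $u$ ranges over all permutations of $[n]=\{1,\dots,n\}$. **Loday's associahedron.** $Y_n$ is the set of full planar rooted binary trees (each internal vertex has a left child and a right child) with $n+1$ leaves labelled $0,1,\dots,n$ from left to right. Such a tree has $n$ internal vertices. For $1\le i\le n$, the $i$th internal vertex is the one that falls in between the leaves $i-1$ and $i$, i.e. the lowest common ancestor of these two leaves. Let $a_i$ (respectively $b_i$) be the number of leaf descendants of the left (respectively right) child of the $i$th vertex, where a child that is itself a leaf counts as one leaf. Define $M_n\colon Y_n\to\mathbb{R}^n$ by $M_n(t)=(a_1b_1,a_2b_2,\dots,a_nb_n)$. $\mathrm{Asso}_n$ is the polytope with vertices $\{M_n(t)\mid t\in Y_n\}$; by a theorem of Loday (2004) it is a polytopal realisation of the Tamari lattice, i.e. an associahedron. **Condorcet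 domains.** A linear order on a finite set $A$ of alternatives is written as a sequence listing each element of $A$ exactly once. A set $\mathcal{D}$ of linear orders on $A$ is a Condorcet domain if, whenever every voter has a preference from $\mathcal{D}$, the pairwise majority relation is acyclic. A Condorcet domain on $A$ is maximal if it is not properly contained in any other Condorcet domain on $A$. **Never-middle.** Never-middle means here that for each triple $i<j<k$ in $[n]$ the domain satisfies the never condition $kN_{\{i,j,k\}}2$: in the restriction of any order of the domain to $\{i,j,k\}$, the alternative $k$ is never in the second (middle) position. **The operation $\star$.** For Condorcet domains $\mathcal{D}_1,\mathcal{D}_2$ on disjoint sets of alternatives, $$\mathcal{D}_1\star\mathcal{D}_2=\{u_1u_2\mid u_1\in\mathcal{D}_1,\ u_2\in\mathcal{D}_2\}\cup\{u_2u_1\mid u_1\in\mathcal{D}_1,\ u_2\in\mathcal{D}_2\},$$ where $uv$ denotes concatenation of sequences. An element $a\in[n]$ is identified with the trivial domain on the single alternative $a$.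
   Formalization: The intersection of Perm_n and Asso_n is read as the set of common vertices of the two polytopes; as solid polytopes the equality fails (for n = 2 both are the segment from (1,2) to (2,1), an infinite set). *)

theory Defs
  imports
    "HOL-Analysis.Analysis"
    "HOL-Combinatorics.Multiset_Permutations"
    "HOL-Library.Sublist"
    "HOL-Library.Tree"
begin

section \<open>Polytopes\<close>

text \<open>
  The space of real \<open>n\<close>-tuples is \<open>real ^ 'n\<close>, where a bijection \<open>pos\<close> from \<open>'n\<close> onto \<open>{1..n}\<close>
  numbers the coordinates. Then \<open>tuple pos x\<close> is the vector \<open>(x 1, ..., x n)\<close>.
\<close>

definition tuple :: "('n::finite \<Rightarrow> nat) \<Rightarrow> (nat \<Rightarrow> nat) \<Rightarrow> real ^ 'n" where
  "tuple pos x = (\<chi> c. real (x (pos c)))"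

definition vertices :: "'a::real_vector set \<Rightarrow> 'a set" where
  "vertices P = {v. v extreme_point_of P}"

definition Perm :: "nat \<Rightarrow> ('n::finite \<Rightarrow> nat) \<Rightarrow> (real ^ 'n) set" where
  "Perm n pos = convex hull {tuple pos u | u. u permutes {1..n}}"

text \<open>
  Full planar rooted binary trees are unlabelled library trees; \<open>size1\<close> counts the leaves.
  With the leaves numbered \<open>0, 1, ...\<close> from left to right, \<open>lca_subtree t p q\<close> is the subtree of \<open>t\<close>
  rooted at the lowest common ancestor of the leaves \<open>p\<close> and \<open>q\<close>.
\<close>

fun lca_subtree :: "'a tree \<Rightarrow> nat \<Rightarrow> nat \<Rightarrow> 'a tree" where
  "lca_subtree Leaf p q = Leaf"
| "lca_subtree (Node l x r) p q =
    (if p < size1 l \<and> q < size1 l then lca_subtree l p q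
     else if size1 l \<le> p \<and> size1 l \<le> q then lca_subtree r (p - size1 l) (q - size1 l)
     else Node l x r)"

definition Y :: "nat \<Rightarrow> unit tree set" where
  "Y n = {t. size1 t = n + 1}"

text \<open>The \<open>i\<close>th coordinate \<open>a\<^sub>i b\<^sub>i\<close> of Loday's point of a tree.\<close>

definition loday :: "unit tree \<Rightarrow> nat \<Rightarrow> nat" where
  "loday t i = size1 (left (lca_subtree t (i - 1) i)) * size1 (right (lca_subtree t (i - 1) i))"

definition Asso :: "nat \<Rightarrow> ('n::finite \<Rightarrow> nat) \<Rightarrow> (real ^ 'n) set" where
  "Asso n pos = convex hull {tuple pos (loday t) | t. t \<in> Y n}"


section \<open>Condorcet domains\<close>

text \<open>
  A linear order on \<open>A\<close> is an element of \<^term>\<open>permutations_of_set A\<close>, the most preferred alternative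
  coming first.
\<close>

definition prefers :: "'a list \<Rightarrow> 'a \<Rightarrow> 'a \<Rightarrow> bool" where
  "prefers u a b \<longleftrightarrow> subseq [a, b] u"

text \<open>A profile is a list with one entry per voter; the majority relation is the strict one.\<close>

definition majority :: "'a list list \<Rightarrow> ('a \<times> 'a) set" where
  "majority P =
    {(a, b). length (filter (\<lambda>u. prefers u a b) P) > length (filter (\<lambda>u. prefers u b a) P)}"

definition Condorcet_domain :: "'a set \<Rightarrow> 'a list set \<Rightarrow> bool" where
  "Condorcet_domain A D \<longleftrightarrow>
    D \<subseteq> permutations_of_set A \<and> (\<forall>P. set P \<subseteq> D \<longrightarrow> acyclic (majority P))"

definition maximal_Condorcet_domain :: "'a set \<Rightarrow> 'a list set \<Rightarrow> bool" where
  "maximal_Condorcet_domain A D \<longleftrightarrow>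
    Condorcet_domain A D \<and> \<not> (\<exists>D'. Condorcet_domain A D' \<and> D \<subset> D')"

text \<open>
  The never condition \<open>kN\<^sub>Tp\<close>; positions are counted from 1, whereas list indices start at 0.
\<close>

definition never :: "'a list set \<Rightarrow> 'a \<Rightarrow> 'a set \<Rightarrow> nat \<Rightarrow> bool" where
  "never D k T p \<longleftrightarrow> (\<forall>u\<in>D. filter (\<lambda>x. x \<in> T) u ! (p - 1) \<noteq> k)"

definition never_middle :: "nat \<Rightarrow> nat list set \<Rightarrow> bool" where
  "never_middle n D \<longleftrightarrow>
    (\<forall>i j k. 1 \<le> i \<and> i < j \<and> j < k \<and> k \<le> n \<longrightarrow> never D k {i, j, k} 2)"

definition star :: "'a list set \<Rightarrow> 'a list set \<Rightarrow> 'a list set"  (infixl \<open>\<star>\<close> 70) where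
  "D\<^sub>1 \<star> D\<^sub>2 = {u\<^sub>1 @ u\<^sub>2 | u\<^sub>1 u\<^sub>2. u\<^sub>1 \<in> D\<^sub>1 \<and> u\<^sub>2 \<in> D\<^sub>2} \<union> {u\<^sub>2 @ u\<^sub>1 | u\<^sub>1 u\<^sub>2. u\<^sub>1 \<in> D\<^sub>1 \<and> u\<^sub>2 \<in> D\<^sub>2}"

text \<open>\<open>(...((1 \<star> 2) \<star> 3) \<star> ...) \<star> n\<close>\<close>

definition iterated_star :: "nat \<Rightarrow> nat list set" where
  "iterated_star n = foldl (\<lambda>D a. D \<star> {[a]}) {[1]} [2..<Suc n]"

text \<open>The sequence \<open>u(1) u(2) ... u(n)\<close>.\<close>

definition word :: "nat \<Rightarrow> (nat \<Rightarrow> nat) \<Rightarrow> nat list" where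
  "word n u = map u [1..<Suc n]"

end

theory Submission
  imports Defs
begin

text \<open>
  A word lies in \<^term>\<open>iterated_star n\<close> iff every letter stands to one side of all smaller letters.
  Hence in a majority cycle both neighbours of the largest alternative would compare with it in the
  same way, which is impossible. Any other order has some \<open>k\<close> between smaller \<open>i\<close> and \<open>j\<close>; the domain
  contains the two cyclic shifts of this triple, so adding the order creates a majority cycle.

  For the geometric part, both polytopes lie in the polyhedron where each sum of \<open>k\<close> consecutive
  coordinates is at least \<open>1 + \<dots> + k\<close>. If the word of \<open>u\<close> is in the domain, the values \<open>1, \<dots>, k\<close>
  occupy consecutive positions for every \<open>k\<close>, so \<open>n\<close> of these inequalities are tight at \<open>u\<close> and
  determine it: \<open>u\<close> is an extreme point. Conversely, if the Loday point of a tree is a permutation,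
  its root coordinate \<open>a b\<close> is at most \<open>n = a + b - 1\<close>; so \<open>a = 1\<close> or \<open>b = 1\<close>, the value \<open>n\<close> stands
  at an end, and one recurses into the nontrivial subtree.
\<close>

subsection \<open>Words of the iterated domain\<close>

lemma iterated_star_1: "iterated_star (Suc 0) = {[1]}"
  by (simp add: iterated_star_def)

lemma iterated_star_Suc:
  assumes "n \<ge> 1"
  shows "iterated_star (Suc n) = (\<lambda>v. v @ [Suc n]) ` iterated_star n \<union> (#) (Suc n) ` iterated_star n"
proof -
  have "[2..<Suc (Suc n)] = [2..<Suc n] @ [Suc n]"
    using assms by simp
  then have "iterated_star (Suc n) = iterated_star n \<star> {[Suc n]}"
    by (simp add: iterated_star_def)
  then show ?thesis
    by (auto simp: star_def)
qed

text \<open>Words grow from \<open>[1]\<close> by placing each new maximum at the right or at the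
  left end. With this rule, later arguments about words need not unfold the
  \<open>foldl\<close>.\<close>

lemma iterated_star_induct [consumes 2, case_names one append cons]:
  assumes "n \<ge> 1" "w \<in> iterated_star n"
    and "P 1 [1]"
    and "\<And>n v. n \<ge> 1 \<Longrightarrow> v \<in> iterated_star n \<Longrightarrow> P n v \<Longrightarrow> P (Suc n) (v @ [Suc n])"
    and "\<And>n v. n \<ge> 1 \<Longrightarrow> v \<in> iterated_star n \<Longrightarrow> P n v \<Longrightarrow> P (Suc n) (Suc n # v)"
  shows "P n w"
  using assms(1,2)
proof (induction n arbitrary: w rule: nat_induct_at_least)
  case base
  then show ?case using assms(3) by (simp add: iterated_star_1)
next
  case (Suc n)
  then show ?case using assms(4,5) by (auto simp: iterated_star_Suc)
qed

lemma set_iterated_star: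
  assumes "n \<ge> 1" "w \<in> iterated_star n"
  shows "set w = {1..n}"
  using assms by (induction rule: iterated_star_induct) auto

lemma distinct_iterated_star:
  assumes "n \<ge> 1" "w \<in> iterated_star n"
  shows "distinct w"
  using assms by (induction rule: iterated_star_induct) (auto simp: set_iterated_star)

lemma iterated_star_subset_permutations:
  assumes "n \<ge> 1"
  shows "iterated_star n \<subseteq> permutations_of_set {1..n}"
  using assms set_iterated_star distinct_iterated_star by (auto simp: permutations_of_set_def)

lemma length_iterated_star:
  assumes "n \<ge> 1" "w \<in> iterated_star n"
  shows "length w = n"
  using assms by (induction rule: iterated_star_induct) auto

lemma iterated_star_nonempty: "n \<ge> 1 \<Longrightarrow> iterated_star n \<noteq> {}"
  by (induction rule: nat_induct_at_least) (auto simp: iterated_star_1 iterated_star_Suc)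

lemma finite_iterated_star:
  assumes "n \<ge> 1"
  shows "finite (iterated_star n)"
  by (rule finite_subset[OF iterated_star_subset_permutations[OF assms]]) simp

text \<open>The words with the new maximum at the right end and those with it at the left end are
  disjoint, and each family is a copy of the previous domain, so every step doubles the
  size.\<close>

lemma card_iterated_star:
  assumes "n \<ge> 1"
  shows "card (iterated_star n) = 2 ^ (n - 1)"
  using assms
proof (induction rule: nat_induct_at_least)
  case base
  then show ?case by (simp add: iterated_star_1)
next
  case (Suc n)
  let ?A = "(\<lambda>v. v @ [Suc n]) ` iterated_star n" and ?B = "(#) (Suc n) ` iterated_star n"
  have "?A \<inter> ?B = {}"
  proof (rule ccontr)
    assume "?A \<inter> ?B \<noteq> {}"
    then obtain v v' where v: "v \<in> iterated_star n" and "v @ [Suc n] = Suc n # v'"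
      by blast
    \<comment> \<open>This is where \<open>n \<ge> 1\<close> enters: for an empty \<open>v\<close>
      the two ends would coincide.\<close>
    moreover have "v \<noteq> []"
      using set_iterated_star[OF Suc.hyps v] Suc.hyps by auto
    ultimately have "Suc n \<in> set v"
      by (cases v) auto
    then show False
      using set_iterated_star[OF Suc.hyps v] by simp
  qed
  moreover have "card ?A = card (iterated_star n)" "card ?B = card (iterated_star n)"
    by (auto intro!: card_image simp: inj_on_def)
  ultimately have "card (iterated_star (Suc n)) = 2 * card (iterated_star n)"
    using Suc.hyps by (simp add: iterated_star_Suc card_Un_disjoint finite_iterated_star)
  then show ?case
    using Suc by (cases n) auto
qed

section \<open>The never-middle condition as a characterisation of the words\<close>

lemma length_filter_pair_outside:
  assumes "distinct v" "i \<in> set v" "j \<in> set v" "i \<noteq> j" "k \<notin> set v"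
  shows "length (filter (\<lambda>x. x \<in> {i, j, k}) v) = 2"
proof -
  have "length (filter (\<lambda>x. x \<in> {i, j, k}) v) = card (set (filter (\<lambda>x. x \<in> {i, j, k}) v))"
    using assms(1) by (intro distinct_card[symmetric]) simp
  also have "set (filter (\<lambda>x. x \<in> {i, j, k}) v) = {i, j}"
    using assms by auto
  finally show ?thesis using assms by simp
qed

text \<open>Induction on the construction. If \<open>k\<close> is an old letter, the new maximum is
  outside the triple and the restriction is unchanged. If \<open>k\<close> is the new maximum, the
  other two letters both lie in \<open>v\<close>, so \<open>k\<close> comes first or last.\<close>

lemma never_middle_iterated_star_word:
  assumes "n \<ge> 1" "w \<in> iterated_star n" "1 \<le> i" "i < j" "j < k" "k \<le> n"
  shows "filter (\<lambda>x. x \<in> {i, j, k}) w ! 1 \<noteq> k"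
  using assms
proof (induction rule: iterated_star_induct)
  case one
  then show ?case by simp
next
  case (append n v)
  show ?case
  proof (cases "k \<le> n")
    case True
    with append show ?thesis by simp
  next
    case False
    with append have k: "k = Suc n" by simp
    have v: "set v = {1..n}" "distinct v"
      using append set_iterated_star distinct_iterated_star by blast+
    have "length (filter (\<lambda>x. x \<in> {i, j, k}) v) = 2"
      using v k append.prems by (intro length_filter_pair_outside) auto
    \<comment> \<open>The part coming from \<open>v\<close> has length 2, so the middle entry, at
      index 1, belongs to it.\<close>
    then have "filter (\<lambda>x. x \<in> {i, j, k}) (v @ [Suc n]) ! 1 \<in> set (filter (\<lambda>x. x \<in> {i, j, k}) v)"
      by (simp add: nth_append del: set_filter)
    then show ?thesis using v k by auto
  qed
next
  case (cons n v)
  show ?case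
  proof (cases "k \<le> n")
    case True
    with cons show ?thesis by simp
  next
    case False
    with cons have k: "k = Suc n" by simp
    have v: "set v = {1..n}" "distinct v"
      using cons set_iterated_star distinct_iterated_star by blast+
    have "length (filter (\<lambda>x. x \<in> {i, j, k}) v) = 2"
      using v k cons.prems by (intro length_filter_pair_outside) auto
    then have "filter (\<lambda>x. x \<in> {i, j, k}) (Suc n # v) ! 1 \<in> set (filter (\<lambda>x. x \<in> {i, j, k}) v)"
      using k by (simp del: set_filter)
    then show ?thesis using v k by auto
  qed
qed

lemma never_middle_iterated_star:
  assumes "n \<ge> 1"
  shows "never_middle n (iterated_star n)"
  using never_middle_iterated_star_word[OF assms] by (simp add: never_middle_def never_def)

lemma filter_eq_singleton: "distinct xs \<Longrightarrow> x \<in> set xs \<Longrightarrow> filter ((=) x) xs = [x]"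
  by (induction xs) (auto simp: filter_empty_conv)

lemma filter_middle_eq:
  assumes "distinct (xs @ m # ys)" "x \<in> set xs" "y \<in> set ys"
  shows "filter (\<lambda>z. z \<in> {x, y, m}) (xs @ m # ys) = [x, m, y]"
proof -
  have "filter (\<lambda>z. z \<in> {x, y, m}) xs = filter (\<lambda>z. x = z) xs"
    using assms by (intro filter_cong) auto
  also have "\<dots> = [x]" using assms by (simp add: filter_eq_singleton)
  finally have "filter (\<lambda>z. z \<in> {x, y, m}) xs = [x]" .
  moreover have "filter (\<lambda>z. z \<in> {x, y, m}) ys = filter (\<lambda>z. y = z) ys"
    using assms by (intro filter_cong) auto
  moreover have "\<dots> = [y]" using assms by (simp add: filter_eq_singleton)
  ultimately show ?thesis by simp
qed

lemma permutations_of_set_remove_max: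
  assumes "v @ [Suc n] \<in> permutations_of_set {1..Suc n} \<or> Suc n # v \<in> permutations_of_set {1..Suc n}"
  shows "v \<in> permutations_of_set {1..n}"
proof -
  have "insert (Suc n) (set v) = {1..Suc n}" "Suc n \<notin> set v" and "distinct v"
    using assms by (auto simp only: permutations_of_set_def mem_Collect_eq set_append distinct_append
        list.set distinct.simps)
  then have "set v = {1..Suc n} - {Suc n}" by blast
  also have "\<dots> = {1..n}" by auto
  finally show ?thesis using \<open>distinct v\<close> by (rule permutations_of_setI)
qed

text \<open>If the largest letter had neighbours on both sides, one letter from each side would form
  with it a triple in which it is the middle one. So it stands at an end; deleting it preserves the
  never conditions, and induction applies.\<close>

lemma never_middle_imp_iterated_star:
  assumes "n \<ge> 1" "w \<in> permutations_of_set {1..n}" "never_middle n {w}"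
  shows "w \<in> iterated_star n"
  using assms
proof (induction n arbitrary: w rule: nat_induct_at_least)
  case base
  then show ?case by (simp add: iterated_star_1)
next
  case (Suc n)
  then have w: "set w = {1..Suc n}" "distinct w"
    by (auto simp: permutations_of_set_def)
  then obtain xs ys where xy: "w = xs @ Suc n # ys"
    by (metis Suc_le_eq atLeastAtMost_iff in_set_conv_decomp le_add1 plus_1_eq_Suc order_refl)
  have "xs = [] \<or> ys = []"
  proof (rule ccontr)
    assume "\<not> ?thesis"
    then obtain x y where x: "x \<in> set xs" and y: "y \<in> set ys"
      by (metis list.set_sel(1))
    then have f: "filter (\<lambda>z. z \<in> {x, y, Suc n}) w = [x, Suc n, y]"
      using w(2) unfolding xy by (intro filter_middle_eq)
    have "x \<in> {1..n}" "y \<in> {1..n}" "x \<noteq> y"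
      using w x y unfolding xy by (fastforce simp: le_Suc_eq)+
    \<comment> \<open>The never condition is stated for increasing triples, while the order of
      \<open>x\<close> and \<open>y\<close> is not known; sorting them leaves the set of three
      letters unchanged.\<close>
    then have "1 \<le> min x y" "min x y < max x y" "max x y < Suc n" "{min x y, max x y, Suc n} = {x, y, Suc n}"
      by (auto simp: min_def max_def)
    then have "filter (\<lambda>z. z \<in> {x, y, Suc n}) w ! (2 - 1) \<noteq> Suc n"
      using Suc.prems(2) unfolding never_middle_def never_def
      by (metis insertI1 order_refl)
    then show False using f by simp
  qed
  then obtain v where v: "w = v @ [Suc n] \<or> w = Suc n # v"
    using xy by auto
  then have "v \<in> permutations_of_set {1..n}"
    using Suc.prems(1) permutations_of_set_remove_max by blast
  moreover have "never_middle n {v}"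
    unfolding never_middle_def never_def
  proof (intro allI impI ballI)
    fix i j k u assume ijk: "1 \<le> i \<and> i < j \<and> j < k \<and> k \<le> n" and u: "u \<in> {v}"
    then have "filter (\<lambda>x. x \<in> {i, j, k}) w = filter (\<lambda>x. x \<in> {i, j, k}) v"
      using v by auto
    then show "filter (\<lambda>x. x \<in> {i, j, k}) u ! (2 - 1) \<noteq> k"
      using Suc.prems(2) ijk u unfolding never_middle_def never_def by (metis le_Suc_eq singletonD singletonI)
  qed
  ultimately show ?case
    using Suc v by (auto simp: iterated_star_Suc)
qed

subsection \<open>Majority relations\<close>

lemma prefers_in_set:
  assumes "prefers u a b"
  shows "a \<in> set u \<and> b \<in> set u"
proof -
  have "subseq [a] [a, b]" "subseq [b] [a, b]" by auto
  then have "subseq [a] u" "subseq [b] u"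
    using assms subseq_order.trans unfolding prefers_def by blast+
  then show ?thesis by (simp add: subseq_singleton_left)
qed

lemma prefers_Cons: "prefers (x # u) a b \<longleftrightarrow> (a = x \<and> b \<in> set u) \<or> prefers u a b"
  using prefers_in_set[of u a b] by (cases "a = x") (auto simp: prefers_def subseq_singleton_left)

lemma prefers_append:
  "prefers (u @ v) a b \<longleftrightarrow> prefers u a b \<or> (a \<in> set u \<and> b \<in> set v) \<or> prefers v a b"
  by (induction u) (auto simp: prefers_Cons dest: prefers_in_set simp: prefers_def[of "[]"])

lemma prefers_asym: "distinct u \<Longrightarrow> prefers u a b \<Longrightarrow> \<not> prefers u b a"
  by (induction u) (auto simp: prefers_Cons prefers_def[of "[]"] dest: prefers_in_set)

text \<open>When \<open>k\<close> is inserted it goes to one end of the word on all smaller letters,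
  and later insertions do not alter relative positions. So in each word all smaller alternatives
  compare with \<open>k\<close> alike.\<close>

lemma iterated_star_prefers_cong:
  assumes "n \<ge> 1" "w \<in> iterated_star n" "1 \<le> a" "1 \<le> b" "a < k" "b < k" "k \<le> n"
  shows "(prefers w a k \<longleftrightarrow> prefers w b k) \<and> (prefers w k a \<longleftrightarrow> prefers w k b)"
  using assms
proof (induction rule: iterated_star_induct)
  case one
  then show ?case by simp
next
  case (append n v)
  then have "set v = {1..n}" using set_iterated_star by blast
  with append show ?case
    by (cases "k = Suc n") (auto simp: prefers_append prefers_Cons prefers_def[of "[]"] dest: prefers_in_set)
next
  case (cons n v)
  then have "set v = {1..n}" using set_iterated_star by blast
  with cons show ?case
    by (cases "k = Suc n") (auto simp: prefers_Cons dest: prefers_in_set)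
qed

lemma majority_witness:
  assumes "(a, b) \<in> majority P"
  shows "\<exists>u\<in>set P. prefers u a b"
proof (rule ccontr)
  assume "\<not> ?thesis"
  then have "filter (\<lambda>u. prefers u a b) P = []" by (simp add: filter_empty_conv)
  with assms show False by (simp add: majority_def)
qed

lemma acyclic_majority_iterated_star:
  assumes "n \<ge> 1" "set P \<subseteq> iterated_star n"
  shows "acyclic (majority P)"
proof (rule ccontr)
  let ?R = "majority P"
  \<comment> \<open>\<open>C\<close> collects the alternatives lying on any majority cycle. Its
    maximum \<open>k\<close> dominates its two cycle neighbours \<open>a\<close> and
    \<open>b\<close>, without an explicit list for the cycle.\<close>
  define C where "C = {x. (x, x) \<in> ?R\<^sup>+}"
  assume "\<not> acyclic ?R"
  then have "C \<noteq> {}" by (auto simp: C_def acyclic_def)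
  have R: "a \<in> {1..n} \<and> b \<in> {1..n}" if "(a, b) \<in> ?R" for a b
    using majority_witness[OF that] assms set_iterated_star[OF assms(1)] prefers_in_set
    by (metis subsetD)
  have "C \<subseteq> {1..n}"
    unfolding C_def using R by (metis (no_types, lifting) mem_Collect_eq subsetI tranclD)
  then have "finite C" by (rule finite_subset) simp
  define k where "k = Max C"
  have "k \<in> C" using \<open>C \<noteq> {}\<close> \<open>finite C\<close> by (simp add: k_def)
  then have k: "(k, k) \<in> ?R\<^sup>+" by (simp add: C_def)
  obtain a b where b: "(k, b) \<in> ?R" "(b, k) \<in> ?R\<^sup>*" and a: "(k, a) \<in> ?R\<^sup>*" "(a, k) \<in> ?R"
    using tranclD[OF k] tranclD2[OF k] by blast
  have "a \<in> C" "b \<in> C"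
    using rtrancl_into_trancl2[OF a(2,1)] rtrancl_into_trancl1[OF b(2,1)] by (simp_all add: C_def)
  then have "a \<le> k" "b \<le> k" using \<open>finite C\<close> by (auto simp: k_def)
  moreover have "a \<noteq> k" "b \<noteq> k" using a(2) b(1) by (auto simp: majority_def)
  ultimately have lt: "a < k" "b < k" by auto
  have "(prefers w a k \<longleftrightarrow> prefers w b k) \<and> (prefers w k a \<longleftrightarrow> prefers w k b)" if "w \<in> set P" for w
    using that assms R[OF a(2)] R[OF b(1)] lt by (intro iterated_star_prefers_cong[of n]) auto
  \<comment> \<open>So \<open>a\<close> and \<open>b\<close> receive the same votes against
    \<open>k\<close>, although \<open>a\<close> beats \<open>k\<close> and \<open>k\<close> beats
    \<open>b\<close>.\<close>
  then have "filter (\<lambda>w. prefers w a k) P = filter (\<lambda>w. prefers w b k) P"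
    "filter (\<lambda>w. prefers w k a) P = filter (\<lambda>w. prefers w k b) P"
    by (auto intro: filter_cong)
  with a(2) b(1) show False by (simp add: majority_def)
qed

lemma Condorcet_domain_iterated_star:
  assumes "n \<ge> 1"
  shows "Condorcet_domain {1..n} (iterated_star n)"
  using acyclic_majority_iterated_star[OF assms] iterated_star_subset_permutations[OF assms]
  by (simp add: Condorcet_domain_def)

section \<open>Cyclic triples and maximality\<close>

lemma iterated_star_extend:
  assumes "m \<ge> 1" "v \<in> iterated_star m" "m \<le> n"
  shows "\<exists>w\<in>iterated_star n. subseq v w"
  using assms(3)
proof (induction rule: dec_induct)
  case base
  then show ?case using assms by auto
next
  case (step k)
  then obtain w where "w \<in> iterated_star k" "subseq v w" by blast
  \<comment> \<open>Appending each further letter at the right end keeps the pattern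
    \<open>v\<close>.\<close>
  then show ?case
    using step assms by (auto simp: iterated_star_Suc intro!: bexI[of _ "w @ [Suc k]"] subseq_order.trans[of v w])
qed

text \<open>Take any word on the letters below the larger of \<open>i\<close> and \<open>j\<close>,
  put the larger one at the end that the pattern asks for, and extend to \<open>n\<close>
  letters.\<close>

lemma iterated_star_pair:
  assumes "1 \<le> i" "1 \<le> j" "i \<noteq> j" "i \<le> n" "j \<le> n"
  shows "\<exists>w\<in>iterated_star n. subseq [i, j] w"
proof -
  define m where "m = max i j - 1"
  have m: "m \<ge> 1" "Suc m \<le> n" using assms by (auto simp: m_def)
  obtain v where v: "v \<in> iterated_star m" using iterated_star_nonempty[OF m(1)] by auto
  have "\<exists>w\<in>iterated_star (Suc m). subseq [i, j] w"
  proof (cases "i < j")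
    case True
    then have "j = Suc m" "i \<in> set v"
      using assms set_iterated_star[OF m(1) v] by (auto simp: m_def)
    then have "subseq ([i] @ [j]) (v @ [Suc m])"
      by (intro list_emb_append_mono) (auto simp: subseq_singleton_left)
    then show ?thesis using v m by (auto simp: iterated_star_Suc)
  next
    case False
    then have "i = Suc m" "j \<in> set v"
      using assms set_iterated_star[OF m(1) v] by (auto simp: m_def)
    then have "subseq [i, j] (Suc m # v)"
      by (auto simp: subseq_singleton_left)
    then show ?thesis using v m by (intro bexI[of _ "Suc m # v"]) (auto simp: iterated_star_Suc)
  qed
  then show ?thesis
    using iterated_star_extend[of "Suc m" _ n] m subseq_order.trans by (metis le_add1 plus_1_eq_Suc)
qed

text \<open>Both orders of \<open>i\<close> and \<open>j\<close> occur among words on the letters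
  below \<open>k\<close>, and \<open>k\<close> may go to either end. This supplies the voters for a
  Condorcet cycle.\<close>

lemma iterated_star_triple:
  assumes "1 \<le> i" "1 \<le> j" "i \<noteq> j" "i < k" "j < k" "k \<le> n"
  shows "\<exists>w\<in>iterated_star n. subseq [i, j, k] w" and "\<exists>w\<in>iterated_star n. subseq [k, i, j] w"
proof -
  obtain m where m: "k = Suc m" "m \<ge> 1" using assms by (cases k) auto
  then obtain v where v: "v \<in> iterated_star m" "subseq [i, j] v"
    using iterated_star_pair[of i j m] assms by auto
  have "subseq ([i, j] @ [k]) (v @ [Suc m])" "subseq [k, i, j] (Suc m # v)"
    using v m by (auto intro: list_emb_append_mono simp del: append.simps)
  then have "\<exists>w\<in>iterated_star k. subseq [i, j, k] w" "\<exists>w\<in>iterated_star k. subseq [k, i, j] w"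
    using v m by (auto simp: iterated_star_Suc)
  then show "\<exists>w\<in>iterated_star n. subseq [i, j, k] w" "\<exists>w\<in>iterated_star n. subseq [k, i, j] w"
    using iterated_star_extend[of k _ n] assms subseq_order.trans by (metis less_imp_le order_trans)+
qed

lemma subseq3_prefers:
  assumes "subseq [a, b, c] u"
  shows "prefers u a b" "prefers u b c" "prefers u a c"
proof -
  have "subseq [a, b] [a, b, c]" "subseq [b, c] [a, b, c]" "subseq [a, c] [a, b, c]" by auto
  then show "prefers u a b" "prefers u b c" "prefers u a c"
    using assms subseq_order.trans unfolding prefers_def by blast+
qed

text \<open>Condorcet's paradox: each of \<open>a\<close> over \<open>b\<close>, \<open>b\<close>
  over \<open>c\<close> and \<open>c\<close> over \<open>a\<close> wins by two votes to one.\<close>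

lemma cyclic_triple_not_acyclic:
  assumes "distinct u" "distinct v" "distinct w"
    and "subseq [a, b, c] u" "subseq [b, c, a] v" "subseq [c, a, b] w"
  shows "\<not> acyclic (majority [u, v, w])"
proof -
  note p = subseq3_prefers[OF assms(4)] subseq3_prefers[OF assms(5)] subseq3_prefers[OF assms(6)]
  note q = p[THEN prefers_asym[rotated]]
  have "(a, b) \<in> majority [u, v, w]" "(b, c) \<in> majority [u, v, w]" "(c, a) \<in> majority [u, v, w]"
    using p q assms(1-3) by (auto simp: majority_def)
  then have "(a, a) \<in> (majority [u, v, w])\<^sup>+"
    by (meson trancl.simps)
  then show ?thesis by (auto simp: acyclic_def)
qed

lemma middle_subseq:
  assumes "distinct u" "{i, j, k} \<subseteq> set u" "i \<noteq> j" "i \<noteq> k" "j \<noteq> k"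
    and "filter (\<lambda>x. x \<in> {i, j, k}) u ! 1 = k"
  shows "subseq [i, k, j] u \<or> subseq [j, k, i] u"
proof -
  let ?f = "filter (\<lambda>x. x \<in> {i, j, k}) u"
  have d: "distinct ?f" and s: "set ?f = {i, j, k}" using assms by auto
  then have "length ?f = 3" using distinct_card[OF d] assms by simp
  then obtain x y z where f: "?f = [x, y, z]"
    by (auto simp: numeral_3_eq_3 length_Suc_conv)
  have "distinct [x, y, z]" "set [x, y, z] = {i, j, k}" "[x, y, z] ! 1 = k"
    using d s assms(6) unfolding f by simp_all
  moreover from this(2) have "x \<in> {i, j, k}" "z \<in> {i, j, k}"
    by auto
  ultimately have "[x, y, z] = [i, k, j] \<or> [x, y, z] = [j, k, i]"
    by auto
  then have "?f = [i, k, j] \<or> ?f = [j, k, i]"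
    unfolding f .
  then show ?thesis by (metis subseq_filter_left)
qed

lemma maximal_iterated_star:
  assumes "n \<ge> 1"
  shows "maximal_Condorcet_domain {1..n} (iterated_star n)"
  unfolding maximal_Condorcet_domain_def
proof (intro conjI notI)
  show "Condorcet_domain {1..n} (iterated_star n)"
    using assms by (rule Condorcet_domain_iterated_star)
next
  assume "\<exists>D. Condorcet_domain {1..n} D \<and> iterated_star n \<subset> D"
  then obtain D u where D: "Condorcet_domain {1..n} D" "iterated_star n \<subseteq> D"
    and u: "u \<in> D" "u \<notin> iterated_star n"
    by auto
  have perm: "set w = {1..n}" "distinct w" if "w \<in> D" for w
    using that D(1) by (auto simp: Condorcet_domain_def permutations_of_set_def)
  have "\<not> never_middle n {u}"
    using never_middle_imp_iterated_star[OF assms] u D(1) by (auto simp: Condorcet_domain_def)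
  then obtain i j k where ijk: "1 \<le> i" "i < j" "j < k" "k \<le> n"
    and "filter (\<lambda>x. x \<in> {i, j, k}) u ! 1 = k"
    by (auto simp: never_middle_def never_def)
  then have "subseq [i, k, j] u \<or> subseq [j, k, i] u"
    using perm[OF u(1)] by (intro middle_subseq) auto
  \<comment> \<open>\<open>a\<close> and \<open>b\<close> are \<open>i\<close> and \<open>j\<close>
    in the order in which they occur in \<open>u\<close>.\<close>
  then obtain a b where ab: "subseq [a, k, b] u" "a \<noteq> b" "1 \<le> a" "1 \<le> b" "a < k" "b < k"
    using ijk by (metis less_imp_le less_trans order_trans nat_neq_iff)
  \<comment> \<open>The two cyclic shifts of \<open>[a, k, b]\<close> have \<open>k\<close> at an
    end, so words of the domain contain them.\<close>
  then obtain v w where "v \<in> iterated_star n" "w \<in> iterated_star n"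
    and "subseq [k, b, a] v" "subseq [b, a, k] w"
    using iterated_star_triple[of b a k n] ijk by metis
  moreover have "acyclic (majority [u, v, w])" if "v \<in> D" "w \<in> D" for v w
    using D(1) u that by (simp add: Condorcet_domain_def)
  ultimately show False
    using ab(1) cyclic_triple_not_acyclic[of u v w a k b] perm D(2) u(1) by blast
qed

text \<open>A never-middle domain consists of words of \<open>iterated_star n\<close> by the
  characterisation, so a maximal one cannot be smaller.\<close>

lemma never_middle_maximal_unique:
  assumes "n \<ge> 1" "maximal_Condorcet_domain {1..n} D" "never_middle n D"
  shows "D = iterated_star n"
proof -
  have "D \<subseteq> iterated_star n"
  proof
    fix w assume "w \<in> D"
    moreover from this have "never_middle n {w}"
      using assms(3) by (simp add: never_middle_def never_def)
    ultimately show "w \<in> iterated_star n"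
      using assms by (intro never_middle_imp_iterated_star)
        (auto simp: maximal_Condorcet_domain_def Condorcet_domain_def)
  qed
  then show ?thesis
    using assms Condorcet_domain_iterated_star by (auto simp: maximal_Condorcet_domain_def)
qed

subsection \<open>Interval inequalities and extreme points\<close>

text \<open>The leaves \<open>i - 1\<close> and \<open>i\<close> lie both in \<open>l\<close>, or
  both in \<open>r\<close>, or are separated by the root; the last happens exactly for
  \<open>i = size1 l\<close>.\<close>

lemma loday_Node:
  assumes "1 \<le> i"
  shows "loday (Node l x r) i =
    (if i < size1 l then loday l i else if i = size1 l then size1 l * size1 r
     else loday r (i - size1 l))"
proof -
  have "i - Suc (size1 l) = i - 1 - size1 l" "i < size1 l \<Longrightarrow> i - 1 < size1 l"
    "size1 l < i \<Longrightarrow> size1 l \<le> i - 1"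
    by auto
  then show ?thesis
    using assms by (auto simp: loday_def)
qed

text \<open>The bound is the triangular number of \<open>k\<close>, doubled to avoid division. Only
  a window containing the root needs work: with \<open>a\<close> positions to the left of the root
  and \<open>b\<close> to the right, the root contributes at least \<open>(a + 1) * (b + 1)\<close>,
  which is what the triangular numbers of \<open>a\<close> and \<open>b\<close> lack to that of
  \<open>a + b + 1\<close>.\<close>

lemma loday_interval_sum_ge:
  assumes "p + k \<le> size t"
  shows "k * (k + 1) \<le> 2 * (\<Sum>i\<in>{p<..p + k}. loday t i)"
  using assms
proof (induction t arbitrary: p k)
  case Leaf
  then show ?case by simp
next
  case (Node l x r)
  let ?s = "size1 l" and ?t = "Node l x r"
  consider "p + k < ?s" | "?s \<le> p" | "p < ?s" "?s \<le> p + k" by linarith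
  then show ?case
  proof cases
    case 1
    then have "(\<Sum>i\<in>{p<..p + k}. loday ?t i) = (\<Sum>i\<in>{p<..p + k}. loday l i)"
      by (intro sum.cong) (auto simp: loday_Node)
    with 1 Node.IH(1)[of p k] show ?thesis by (simp add: size1_size)
  next
    case 2
    have "(\<Sum>i\<in>{p<..p + k}. loday ?t i) = (\<Sum>i\<in>{p - ?s<..p - ?s + k}. loday r i)"
      using 2 by (intro sum.reindex_bij_witness[of _ "\<lambda>i. i + ?s" "\<lambda>i. i - ?s"]) (auto simp: loday_Node)
    with 2 Node.prems Node.IH(2)[of "p - ?s" k] show ?thesis by (simp add: size1_size)
  next
    case 3
    define a b where "a = ?s - Suc p" and "b = p + k - ?s"
    have ab: "p + a + 1 = ?s" "?s + b = p + k" "k = a + b + 1" using 3 by (auto simp: a_def b_def)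
    have "{p<..p + k} = {p<..p + a} \<union> {?s} \<union> {?s<..?s + b}" using ab by auto
    then have "(\<Sum>i\<in>{p<..p + k}. loday ?t i) =
        (\<Sum>i\<in>{p<..p + a} \<union> {?s}. loday ?t i) + (\<Sum>i\<in>{?s<..?s + b}. loday ?t i)"
      using ab by (simp only:) (intro sum.union_disjoint; auto)
    also have "(\<Sum>i\<in>{p<..p + a} \<union> {?s}. loday ?t i) = (\<Sum>i\<in>{p<..p + a}. loday ?t i) + loday ?t ?s"
      using ab by simp
    also have "(\<Sum>i\<in>{p<..p + a}. loday ?t i) = (\<Sum>i\<in>{p<..p + a}. loday l i)"
      using ab by (intro sum.cong) (auto simp: loday_Node)
    also have "(\<Sum>i\<in>{?s<..?s + b}. loday ?t i) = (\<Sum>i\<in>{0<..0 + b}. loday r i)"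
      by (intro sum.reindex_bij_witness[of _ "\<lambda>i. i + ?s" "\<lambda>i. i - ?s"]) (auto simp: loday_Node)
    finally have S: "(\<Sum>i\<in>{p<..p + k}. loday ?t i) =
        (\<Sum>i\<in>{p<..p + a}. loday l i) + loday ?t ?s + (\<Sum>i\<in>{0<..0 + b}. loday r i)" .
    have "a * (a + 1) \<le> 2 * (\<Sum>i\<in>{p<..p + a}. loday l i)"
      using ab by (intro Node.IH(1)) (simp add: size1_size)
    moreover have b: "b * (b + 1) \<le> 2 * (\<Sum>i\<in>{0<..0 + b}. loday r i)"
      using ab Node.prems by (intro Node.IH(2)) (simp add: size1_size)
    moreover have "(a + 1) * (b + 1) \<le> loday ?t ?s"
    proof -
      have "a + 1 \<le> size1 l" "b + 1 \<le> size1 r"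
        using ab Node.prems by (auto simp: size1_size)
      then show ?thesis by (simp only: loday_Node) (simp add: mult_le_mono size1_ge0 Suc_leI del: mult_Suc mult_Suc_right)
    qed
    moreover have "k * (k + 1) = a * (a + 1) + 2 * ((a + 1) * (b + 1)) + b * (b + 1)"
      using ab by (simp add: algebra_simps)
    \<comment> \<open>With products and sums kept as atoms, the combination of the bounds is
      linear.\<close>
    moreover have "K \<le> 2 * (x + y + z)"
      if "A \<le> 2 * x" "B \<le> 2 * z" "C \<le> y" "K = A + 2 * C + B" for A B C K x y z :: nat
      using that by simp
    ultimately show ?thesis unfolding S by blast
  qed
qed

section \<open>Sums over permutations and intervals of positions\<close>

lemma sum_distinct_positive_ge:
  fixes S :: "nat set"
  assumes "finite S" "0 \<notin> S"
  shows "card S * (card S + 1) \<le> 2 * \<Sum>S"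
  using assms
proof (induction "card S" arbitrary: S)
  case 0
  then show ?case by simp
next
  case (Suc k)
  let ?m = "Max S"
  have "S \<noteq> {}" using Suc.hyps by auto
  then have m: "?m \<in> S" using Suc.prems by simp
  \<comment> \<open>Hence the maximum is at least the cardinality, and removing it leaves the bound
    for one element less.\<close>
  have "S \<subseteq> {1..?m}" using Suc.prems by (auto simp: Suc_le_eq intro: gr0I)
  then have "Suc k \<le> ?m" using card_mono[of "{1..?m}" S] Suc.hyps by simp
  moreover have "k * (k + 1) \<le> 2 * \<Sum>(S - {?m})"
  proof -
    have "k = card (S - {?m})" using Suc.hyps(2) Suc.prems m by simp
    then show ?thesis using Suc.hyps(1)[of "S - {?m}"] Suc.prems by simp
  qed
  moreover have "\<Sum>S = ?m + \<Sum>(S - {?m})"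
    using m Suc.prems by (simp add: sum.remove)
  ultimately show ?case
    using Suc.hyps(2)[symmetric] by simp
qed

lemma permutes_sum_ge:
  fixes u :: "nat \<Rightarrow> nat"
  assumes "u permutes {1..n}" "S \<subseteq> {1..n}"
  shows "card S * (card S + 1) \<le> 2 * sum u S"
proof -
  have inj: "inj_on u S" using assms(1) permutes_inj inj_on_subset by blast
  have "u ` S \<subseteq> {1..n}" using assms permutes_image by blast
  then have "0 \<notin> u ` S" "finite (u ` S)" by (auto intro: finite_subset)
  then show ?thesis
    using sum_distinct_positive_ge[of "u ` S"] inj by (simp add: card_image sum.reindex)
qed

text \<open>A new maximum at an end does not interrupt the block of values up to \<open>k\<close>:
  appending keeps its offset \<open>p\<close>, prepending shifts it by one. For \<open>k\<close>
  equal to the full length the block is the whole word.\<close>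

lemma iterated_star_initial_values_interval:
  assumes "n \<ge> 1" "w \<in> iterated_star n" "k \<le> n"
  shows "\<exists>p. p + k \<le> n \<and> (\<forall>i<n. w ! i \<le> k \<longleftrightarrow> p \<le> i \<and> i < p + k)"
  using assms
proof (induction rule: iterated_star_induct)
  case one
  then show ?case by (intro exI[of _ 0]) auto
next
  case (append n v)
  have v: "length v = n" "set v = {1..n}"
    using append length_iterated_star set_iterated_star by blast+
  show ?case
  proof (cases "k = Suc n")
    case True
    have "(v @ [Suc n]) ! i \<le> k" if "i < Suc n" for i
      using that v True nth_mem[of i v] by (auto simp: nth_append less_Suc_eq)
    then show ?thesis using True by (intro exI[of _ 0]) auto
  next
    case False
    then obtain p where "p + k \<le> n" "\<forall>i<n. v ! i \<le> k \<longleftrightarrow> p \<le> i \<and> i < p + k"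
      using append by auto
    then show ?thesis
      using v False append.prems by (intro exI[of _ p]) (auto simp: nth_append less_Suc_eq)
  qed
next
  case (cons n v)
  have v: "length v = n" "set v = {1..n}"
    using cons length_iterated_star set_iterated_star by blast+
  show ?case
  proof (cases "k = Suc n")
    case True
    have "(Suc n # v) ! i \<le> k" if "i < Suc n" for i
      using that v True nth_mem[of "i - 1" v] by (cases i) auto
    then show ?thesis using True by (intro exI[of _ 0]) auto
  next
    case False
    then obtain p where "p + k \<le> n" "\<forall>i<n. v ! i \<le> k \<longleftrightarrow> p \<le> i \<and> i < p + k"
      using cons by auto
    then show ?thesis
      using v False cons.prems by (intro exI[of _ "Suc p"]) (auto simp: nth_Cons split: nat.split)
  qed
qed

text \<open>A common outer polyhedron for both polytopes: a point that is extreme here is extreme in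
  each of them that contains it. These are the interval inequalities of Loday's associahedron,
  without the equation for the sum of all coordinates.\<close>

definition interval_polyhedron :: "nat \<Rightarrow> ('n::finite \<Rightarrow> nat) \<Rightarrow> (real ^ 'n) set" where
  "interval_polyhedron n pos =
    {x. \<forall>p k. p + k \<le> n \<longrightarrow> real (k * (k + 1)) \<le> 2 * (\<Sum>c | pos c \<in> {p<..p + k}. x $ c)}"

lemma convex_interval_polyhedron: "convex (interval_polyhedron n pos)"
  unfolding convex_def
proof (intro ballI allI impI)
  fix x y and s t :: real
  assume x: "x \<in> interval_polyhedron n pos" and y: "y \<in> interval_polyhedron n pos"
    and st: "0 \<le> s" "0 \<le> t" "s + t = 1"
  show "s *\<^sub>R x + t *\<^sub>R y \<in> interval_polyhedron n pos"
    unfolding interval_polyhedron_def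
  proof (intro CollectI allI impI)
    fix p k assume pk: "p + k \<le> n"
    let ?S = "\<lambda>z. 2 * (\<Sum>c | pos c \<in> {p<..p + k}. z $ c)"
    have "real (k * (k + 1)) \<le> ?S x" "real (k * (k + 1)) \<le> ?S y"
      using x y pk by (auto simp: interval_polyhedron_def)
    then have "s * real (k * (k + 1)) + t * real (k * (k + 1)) \<le> s * ?S x + t * ?S y"
      using st by (intro add_mono mult_left_mono) auto
    moreover have "s * real (k * (k + 1)) + t * real (k * (k + 1)) = real (k * (k + 1))"
      using st by (metis distrib_right mult_1)
    moreover have "s * ?S x + t * ?S y = ?S (s *\<^sub>R x + t *\<^sub>R y)"
      by (simp add: sum.distrib sum_distrib_left algebra_simps)
    ultimately show "real (k * (k + 1)) \<le> ?S (s *\<^sub>R x + t *\<^sub>R y)" by linarith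
  qed
qed

lemma sum_tuple:
  assumes "bij_betw pos (UNIV :: 'n::finite set) {1..n}" "S \<subseteq> {1..n}"
  shows "(\<Sum>c | pos c \<in> S. tuple pos x $ c) = real (sum x S)"
proof -
  have "pos ` {c. pos c \<in> S} = S" "inj_on pos {c. pos c \<in> S}"
    using assms by (auto simp: bij_betw_def inj_on_def image_iff)
  then have "sum x S = (\<Sum>c | pos c \<in> S. x (pos c))"
    by (metis (no_types, lifting) sum.reindex_cong)
  then show ?thesis by (simp add: tuple_def)
qed

lemma tuple_in_interval_polyhedron:
  assumes "bij_betw pos (UNIV :: 'n::finite set) {1..n}"
    and "\<And>p k. p + k \<le> n \<Longrightarrow> k * (k + 1) \<le> 2 * sum x {p<..p + k}"
  shows "tuple pos x \<in> interval_polyhedron n pos"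
  unfolding interval_polyhedron_def
proof (intro CollectI allI impI)
  fix p k assume pk: "p + k \<le> n"
  then have "(\<Sum>c | pos c \<in> {p<..p + k}. tuple pos x $ c) = real (sum x {p<..p + k})"
    using assms(1) by (intro sum_tuple) auto
  moreover have "real (k * (k + 1)) \<le> real (2 * sum x {p<..p + k})"
    using assms(2)[OF pk] by (simp only: of_nat_le_iff)
  ultimately show "real (k * (k + 1)) \<le> 2 * (\<Sum>c | pos c \<in> {p<..p + k}. tuple pos x $ c)"
    by simp
qed

lemma Perm_subset_interval_polyhedron:
  assumes "bij_betw pos (UNIV :: 'n::finite set) {1..n}"
  shows "Perm n pos \<subseteq> interval_polyhedron n pos"
  unfolding Perm_def
proof (rule hull_minimal)
  show "{tuple pos u |u. u permutes {1..n}} \<subseteq> interval_polyhedron n pos"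
  proof clarify
    fix u assume u: "u permutes {1..n}"
    show "tuple pos u \<in> interval_polyhedron n pos"
    proof (rule tuple_in_interval_polyhedron[OF assms])
      fix p k assume "p + k \<le> n"
      then show "k * (k + 1) \<le> 2 * sum u {p<..p + k}"
        using permutes_sum_ge[OF u, of "{p<..p + k}"] by (simp add: subset_eq)
    qed
  qed
qed (rule convex_interval_polyhedron)

lemma Asso_subset_interval_polyhedron:
  assumes "bij_betw pos (UNIV :: 'n::finite set) {1..n}"
  shows "Asso n pos \<subseteq> interval_polyhedron n pos"
  unfolding Asso_def
proof (rule hull_minimal)
  show "{tuple pos (loday t) |t. t \<in> Y n} \<subseteq> interval_polyhedron n pos"
  proof clarify
    fix t assume "t \<in> Y n"
    then have "size t = n" by (simp add: Y_def size1_size)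
    then show "tuple pos (loday t) \<in> interval_polyhedron n pos"
      using loday_interval_sum_ge by (intro tuple_in_interval_polyhedron[OF assms]) blast
  qed
qed (rule convex_interval_polyhedron)

lemma length_word [simp]: "length (word n u) = n"
  by (simp add: word_def)

lemma nth_word [simp]: "i < n \<Longrightarrow> word n u ! i = u (Suc i)"
  by (simp add: word_def del: upt_Suc)

lemma word_cong: "(\<And>i. i \<in> {1..n} \<Longrightarrow> u i = v i) \<Longrightarrow> word n u = word n v"
  by (auto simp: word_def)

lemma word_permutes:
  assumes "u permutes {1..n}"
  shows "word n u \<in> permutations_of_set {1..n}"
proof -
  have "set (word n u) = u ` {1..n}"
    by (simp only: word_def set_map set_upt atLeastLessThanSuc_atLeastAtMost)
  then show ?thesis
    using permutes_image[OF assms] permutes_inj_on[OF assms]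
    by (simp add: permutations_of_set_def word_def distinct_map)
qed

lemma iterated_star_extreme:
  assumes "n \<ge> 1" "bij_betw pos (UNIV :: 'n::finite set) {1..n}"
    and u: "u permutes {1..n}" and w: "word n u \<in> iterated_star n"
  shows "tuple pos u extreme_point_of interval_polyhedron n pos"
  unfolding extreme_point_of_def
proof (intro conjI ballI notI)
  have "tuple pos u \<in> Perm n pos"
    unfolding Perm_def using u by (intro hull_inc) auto
  then show "tuple pos u \<in> interval_polyhedron n pos"
    using Perm_subset_interval_polyhedron[OF assms(2)] by blast
next
  fix a b
  assume ab: "a \<in> interval_polyhedron n pos" "b \<in> interval_polyhedron n pos"
    and "tuple pos u \<in> open_segment a b"
  then obtain t where t: "a \<noteq> b" "0 < t" "t < 1" "tuple pos u = (1 - t) *\<^sub>R a + t *\<^sub>R b"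
    by (auto simp: in_segment)
  have pos: "pos c \<in> {1..n}" for c
    using assms(2) by (auto simp: bij_betw_def)
  \<comment> \<open>\<open>F k\<close> sums the coordinates at which \<open>u\<close> takes values
    up to \<open>k\<close>. These positions form an interval, so \<open>F k\<close> is bounded below
    on the polyhedron, with equality at \<open>u\<close>.\<close>
  define F where "F k z = (\<Sum>c | u (pos c) \<le> k. z $ c)" for k and z :: "real ^ 'n"
  have F_eq: "F k a = F k b" if k: "k \<le> n" for k
  proof -
    obtain p where p: "p + k \<le> n" "\<forall>i<n. word n u ! i \<le> k \<longleftrightarrow> p \<le> i \<and> i < p + k"
      using iterated_star_initial_values_interval[OF assms(1) w k] by blast
    have p': "u i \<le> k \<longleftrightarrow> i \<in> {p<..p + k}" if "i \<in> {1..n}" for i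
      using that p(2) by (cases i) auto
    then have S: "{c. u (pos c) \<le> k} = {c. pos c \<in> {p<..p + k}}"
      using pos by blast
    have ge: "real (k * (k + 1)) \<le> 2 * F k z" if "z \<in> interval_polyhedron n pos" for z
      using that p(1) unfolding F_def S interval_polyhedron_def by blast
    have "u ` {p<..p + k} = {1..k}"
    proof
      show "u ` {p<..p + k} \<subseteq> {1..k}"
        using p' p(1) permutes_in_image[OF u] by fastforce
      show "{1..k} \<subseteq> u ` {p<..p + k}"
      proof
        fix y assume y: "y \<in> {1..k}"
        then have "y \<in> u ` {1..n}" using k permutes_image[OF u] by auto
        then show "y \<in> u ` {p<..p + k}" using p' y by auto
      qed
    qed
    then have "sum u {p<..p + k} = \<Sum>{1..k}"
      using sum.reindex[of u "{p<..p + k}" id] permutes_inj_on[OF u] by simp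
    then have "2 * sum u {p<..p + k} = k * (k + 1)"
      using double_gauss_sum_from_Suc_0[of k, where ?'a = nat] by simp
    moreover have "F k (tuple pos u) = real (sum u {p<..p + k})"
      unfolding F_def S using p(1) by (intro sum_tuple[OF assms(2)]) auto
    ultimately have "2 * F k (tuple pos u) = real (k * (k + 1))"
      by (metis of_nat_mult of_nat_numeral)
    moreover have "F k (tuple pos u) = (1 - t) * F k a + t * F k b"
      unfolding t(4) F_def by (simp add: sum.distrib sum_distrib_left)
    \<comment> \<open>A positive combination of the two nonnegative slacks vanishes, so both slacks
      vanish.\<close>
    ultimately have "(1 - t) * (2 * F k a - real (k * (k + 1))) + t * (2 * F k b - real (k * (k + 1))) = 0"
      by (simp add: algebra_simps)
    moreover have "0 \<le> (1 - t) * (2 * F k a - real (k * (k + 1)))" "0 \<le> t * (2 * F k b - real (k * (k + 1)))"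
      using ge[OF ab(1)] ge[OF ab(2)] t by (auto intro!: mult_nonneg_nonneg)
    ultimately have "(1 - t) * (2 * F k a - real (k * (k + 1))) = 0" "t * (2 * F k b - real (k * (k + 1))) = 0"
      by linarith+
    then show ?thesis using t by auto
  qed
  have "a $ c = b $ c" for c
  proof -
    let ?k = "u (pos c)"
    have k: "?k \<in> {1..n}" using pos permutes_in_image[OF u] by blast
    \<comment> \<open>By injectivity, passing from \<open>?k - 1\<close> to \<open>?k\<close> adds
      the single coordinate \<open>c\<close>, so the values of \<open>F\<close> determine every
      coordinate.\<close>
    have "inj (\<lambda>c. u (pos c))"
      using assms(2) permutes_inj[OF u] by (auto simp: bij_betw_def inj_def)
    then have "u (pos d) \<noteq> ?k" if "d \<noteq> c" for d
      using that by (auto dest: injD)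
    then have "u (pos d) \<le> ?k \<longleftrightarrow> d = c \<or> u (pos d) \<le> ?k - 1" for d
      using k by (cases "d = c") (simp, fastforce)
    then have "{d. u (pos d) \<le> ?k} = insert c {d. u (pos d) \<le> ?k - 1}"
      by blast
    moreover have "c \<notin> {d. u (pos d) \<le> ?k - 1}" using k by auto
    ultimately have "F ?k z = z $ c + F (?k - 1) z" for z
      unfolding F_def by simp
    from this[of a] this[of b] show ?thesis
      using F_eq[of ?k] F_eq[of "?k - 1"] k by fastforce
  qed
  then show False using t(1) by (simp add: vec_eq_iff)
qed

lemma extreme_point_of_subset:
  assumes "x extreme_point_of T" "S \<subseteq> T" "x \<in> S"
  shows "x extreme_point_of S"
  using assms by (auto simp: extreme_point_of_def)

subsection \<open>Loday points that are permutations\<close>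

text \<open>The coordinates of a Loday point follow the in-order traversal of the tree, which lets
  trees be compared with the recursive words.\<close>

lemma word_loday_Node:
  "word (size (Node l x r)) (loday (Node l x r)) =
    word (size l) (loday l) @ [size1 l * size1 r] @ word (size r) (loday r)"
  by (rule nth_equalityI) (auto simp: nth_append loday_Node size1_size nth_Cons split: nat.split)

text \<open>A new root with a leaf as its other child has coordinate \<open>(n + 1) * 1\<close>. It
  comes last if the old tree is the left child and first if it is the right child, matching the two
  ways to extend a word.\<close>

lemma iterated_star_loday:
  assumes "n \<ge> 1" "w \<in> iterated_star n"
  shows "\<exists>t. size t = n \<and> word n (loday t) = w"
  using assms
proof (induction rule: iterated_star_induct)
  case one
  then show ?case
    by (intro exI[of _ "Node Leaf () Leaf"]) (simp add: word_def loday_def)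
next
  case (append n v)
  then obtain t where "size t = n" "word n (loday t) = v" by blast
  then show ?case
    using word_loday_Node[of t "()" Leaf]
    by (intro exI[of _ "Node t () Leaf"]) (simp add: size1_size word_def[of 0])
next
  case (cons n v)
  then obtain t where "size t = n" "word n (loday t) = v" by blast
  then show ?case
    using word_loday_Node[of Leaf "()" t]
    by (intro exI[of _ "Node Leaf () t"]) (simp add: size1_size word_def[of 0])
qed

lemma loday_permutation_iterated_star:
  assumes "size t \<ge> 1" "word (size t) (loday t) \<in> permutations_of_set {1..size t}"
  shows "word (size t) (loday t) \<in> iterated_star (size t)"
  using assms
proof (induction t)
  case Leaf
  then show ?case by simp
next
  case (Node l x r)
  let ?n = "size l + size r + 1" and ?L = "word (size l) (loday l)" and ?R = "word (size r) (loday r)"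
  let ?w = "?L @ [size1 l * size1 r] @ ?R"
  have w: "?w \<in> permutations_of_set {1..?n}"
    using Node.prems(2) unfolding word_loday_Node by simp
  have "size1 l * size1 r \<in> set ?w" by simp
  then have "size1 l * size1 r \<le> ?n"
    unfolding permutations_of_setD(1)[OF w] by simp
  \<comment> \<open>The inequality
    \<open>(size l + 1) * (size r + 1) \<le> size l + size r + 1\<close> says that
    \<open>size l * size r = 0\<close>.\<close>
  then have "size l = 0 \<or> size r = 0" by (simp add: size1_size)
  then show ?case
  proof
    assume 0: "size r = 0"
    then have w': "?w = ?L @ [Suc (size l)]" and n: "?n = Suc (size l)" "size l + size r + Suc 0 = Suc (size l)"
      by (auto simp: word_def size1_size)
    \<comment> \<open>The tree with one vertex is separate, since the recursion for
      \<open>iterated_star\<close> starts from a word of length at least 1.\<close>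
    show ?thesis
    proof (cases "size l = 0")
      case True
      then show ?thesis unfolding word_loday_Node unfolding w' tree.size n by (simp add: iterated_star_1 word_def)
    next
      case False
      then have ge: "1 \<le> size l" by linarith
      have "?L \<in> permutations_of_set {1..size l}"
        using w unfolding w' n by (blast intro: permutations_of_set_remove_max)
      then have "?L \<in> iterated_star (size l)"
        by (rule Node.IH(1)[OF ge])
      then show ?thesis
        unfolding word_loday_Node unfolding w' tree.size n iterated_star_Suc[OF ge] by simp
    qed
  next
    assume 0: "size l = 0"
    then have w': "?w = Suc (size r) # ?R" and n: "?n = Suc (size r)" "size l + size r + Suc 0 = Suc (size r)"
      by (auto simp: word_def size1_size)
    show ?thesis
    proof (cases "size r = 0")
      case True
      then show ?thesis unfolding word_loday_Node unfolding w' tree.size n by (simp add: iterated_star_1 word_def)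
    next
      case False
      then have ge: "1 \<le> size r" by linarith
      have "?R \<in> permutations_of_set {1..size r}"
        using w unfolding w' n by (blast intro: permutations_of_set_remove_max)
      then have "?R \<in> iterated_star (size r)"
        by (rule Node.IH(2)[OF ge])
      then show ?thesis
        unfolding word_loday_Node unfolding w' tree.size n iterated_star_Suc[OF ge] by simp
    qed
  qed
qed

section \<open>The common vertices of the two polytopes\<close>

lemma tuple_eq_iff:
  assumes "bij_betw pos (UNIV :: 'n::finite set) {1..n}"
  shows "tuple pos x = tuple pos y \<longleftrightarrow> (\<forall>i\<in>{1..n}. x i = y i)"
proof -
  have range: "{1..n} = range pos" using assms by (simp add: bij_betw_def)
  show ?thesis unfolding range by (simp add: tuple_def vec_eq_iff)
qed

lemma vertices_Perm_Int_Asso: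
  assumes n: "n \<ge> 1" and pos: "bij_betw pos (UNIV :: 'n::finite set) {1..n}"
  shows "vertices (Perm n pos) \<inter> vertices (Asso n pos) =
    {tuple pos u | u. u permutes {1..n} \<and> word n u \<in> iterated_star n}"
proof (intro subset_antisym subsetI)
  fix v assume "v \<in> vertices (Perm n pos) \<inter> vertices (Asso n pos)"
  then have "v extreme_point_of Perm n pos" "v extreme_point_of Asso n pos"
    by (auto simp: vertices_def)
  \<comment> \<open>Every extreme point of a convex hull is one of the generating points, so
    \<open>v\<close> is both a permutation and a Loday point.\<close>
  then obtain u t where u: "u permutes {1..n}" "v = tuple pos u" and t: "t \<in> Y n" "v = tuple pos (loday t)"
    unfolding Perm_def Asso_def by (blast dest!: extreme_point_of_convex_hull)
  then have "word n u = word n (loday t)"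
    using tuple_eq_iff[OF pos] by (metis word_cong)
  moreover have "size t = n" using t by (simp add: Y_def size1_size)
  ultimately have "word n u \<in> iterated_star n"
    using loday_permutation_iterated_star[of t] word_permutes[OF u(1)] n by simp
  then show "v \<in> {tuple pos u | u. u permutes {1..n} \<and> word n u \<in> iterated_star n}"
    using u by blast
next
  fix v assume "v \<in> {tuple pos u | u. u permutes {1..n} \<and> word n u \<in> iterated_star n}"
  then obtain u where u: "u permutes {1..n}" "v = tuple pos u" "word n u \<in> iterated_star n"
    by blast
  then obtain t where t: "size t = n" "word n (loday t) = word n u"
    using iterated_star_loday[OF n] by blast
  have "loday t i = u i" if "i \<in> {1..n}" for i
    using arg_cong[OF t(2), of "\<lambda>w. w ! (i - 1)"] that by (cases i) auto
  then have "v = tuple pos (loday t)"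
    using u(2) tuple_eq_iff[OF pos] by metis
  moreover have "t \<in> Y n" using t by (simp add: Y_def size1_size)
  ultimately have "v \<in> Perm n pos" "v \<in> Asso n pos"
    unfolding Perm_def Asso_def using u by (blast intro: hull_inc)+
  \<comment> \<open>Membership in the hulls does not yet make \<open>v\<close> a vertex; extremality
    is inherited from the outer polyhedron.\<close>
  moreover have "v extreme_point_of interval_polyhedron n pos"
    unfolding u(2) by (rule iterated_star_extreme[OF n pos u(1,3)])
  ultimately show "v \<in> vertices (Perm n pos) \<inter> vertices (Asso n pos)"
    using Perm_subset_interval_polyhedron[OF pos] Asso_subset_interval_polyhedron[OF pos]
    by (auto simp: vertices_def intro: extreme_point_of_subset)
qed

text \<open>The domain is a finite set of orders, so the intersection is read as that of the vertex
  sets. The last conjunct accounts for the definite article in "the maximal never-middle Condorcet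
  domain".\<close>

theorem theorem2:
  fixes n :: nat and pos :: "'n::finite \<Rightarrow> nat"
  assumes "n \<ge> 1"
    and "bij_betw pos (UNIV :: 'n set) {1..n}"
  shows "vertices (Perm n pos) \<inter> vertices (Asso n pos) =
           {tuple pos u | u. u permutes {1..n} \<and> word n u \<in> iterated_star n}
       \<and> maximal_Condorcet_domain {1..n} (iterated_star n)
       \<and> never_middle n (iterated_star n)
       \<and> card (iterated_star n) = 2 ^ (n - 1)
       \<and> (\<forall>D. maximal_Condorcet_domain {1..n} D \<and> never_middle n D \<longrightarrow> D = iterated_star n)"
  using vertices_Perm_Int_Asso[OF assms] maximal_iterated_star[OF assms(1)]
    never_middle_iterated_star[OF assms(1)] card_iterated_star[OF assms(1)]
    never_middle_maximal_unique[OF assms(1)]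
  by blast

end
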